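(* Let $X$ be a Banach space, $\{K_n: n\in\mathbb N\}$ a partition of $\mathbb N$ and $\mathcal I_n$ an ideal on $K_n$ for each $n\in\mathbb N$. If $\mathcal I=\bigoplus_{n\in\mathbb N}\mathcal I_n$, then $c_{0,\mathcal I}(X)$ is isometric to $\ell_\infty((c_{0,\mathcal I_n}(X))_{n\in\mathbb N})$. In particular, $c_{0,\mathcal J^\omega}(X)$ is isometric to $\ell_\infty(c_{0,\mathcal J}(X))$ for any ideal $\mathcal J$ on $\mathbb N$.
   Context: An ideal on a set $S$ is a collection of subsets of $S$ containing $\emptyset$, closed under taking subsets and under finite unions; it is always assumed to contain every finite subset of $S$ (it need not be proper). For an ideal $\mathcal I$ on a countable set $S$ and a Banach space $X$, $c_{0,\mathcal I}(X)$ is the space of bounded families $(x_s)_{s\in S}$ in $X$ such that $\{s\in S:\|x_s\|\ge\varepsilon\}\in\mathcal I$ for every $\varepsilon>0$, with the sup norm. The direct sum $\bigoplus_n\mathcal I_n$ is the ideal on $\mathbb N$ given by $A\in\bigoplus_n\mathcal I_n$ iff $A\cap K_n\in\mathcal I_n$ for all $n$. $\mathcal J^\omega$ denotes $\bigoplus_n\mathcal J_n'$ where $\{K_n:n\in\mathbb N\}$ is a partition of $\mathbb N$ into infinite sets and $\mathcal J_n'$ is an isomorphic copy of $\mathcal J$ on $K_n$ (transported by a bijection); up to isomorphism it does not depend on the choices. $\ell_\infty((X_j)_{j\in\mathbb N})$ is the space of bounded sequences $(x_j)\in\prod_jX_j$ with norm $\sup_j\|x_j\|$; $\ell_\infty(X)$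 is the case $X_j=X$ for all $j$. Isometric means there is a surjective linear isometry. *)

theory Defs
  imports "HOL-Analysis.Analysis"
begin

definition ideal_on :: "'s set \<Rightarrow> 's set set \<Rightarrow> bool" where
  "ideal_on S I \<longleftrightarrow>
     I \<subseteq> Pow S \<and> {} \<in> I \<and>
     (\<forall>A\<in>I. \<forall>B. B \<subseteq> A \<longrightarrow> B \<in> I) \<and>
     (\<forall>A\<in>I. \<forall>B\<in>I. A \<union> B \<in> I) \<and>
     (\<forall>A. A \<subseteq> S \<longrightarrow> finite A \<longrightarrow> A \<in> I)"

text \<open>Empty pieces are allowed; if \<open>K n\<close> is empty, the space below over \<open>K n\<close> is the zero space.\<close>

definition indexed_partition :: "(nat \<Rightarrow> nat set) \<Rightarrow> bool" where
  "indexed_partition K \<longleftrightarrow> disjoint_family K \<and> (\<Union>n. K n) = UNIV"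

definition direct_sum_ideal :: "(nat \<Rightarrow> nat set) \<Rightarrow> (nat \<Rightarrow> nat set set) \<Rightarrow> nat set set" where
  "direct_sum_ideal K I = {A. \<forall>n. A \<inter> K n \<in> I n}"

text \<open>The ideal \<open>J\<^sup>\<omega>\<close>, computed with the partition \<open>K\<close> of the natural numbers into infinite
  sets and the bijections \<open>b n\<close> from the natural numbers onto \<open>K n\<close>, which transport \<open>J\<close> to
  an ideal on \<open>K n\<close>.\<close>

definition omega_power_ideal ::
    "(nat \<Rightarrow> nat set) \<Rightarrow> (nat \<Rightarrow> nat \<Rightarrow> nat) \<Rightarrow> nat set set \<Rightarrow> nat set set" where
  "omega_power_ideal K b J = direct_sum_ideal K (\<lambda>n. (`) (b n) ` J)"

text \<open>Every function on the discrete space \<^typ>\<open>nat\<close> is continuous, so \<^typ>\<open>nat \<Rightarrow>\<^sub>C 'a\<close> is the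
  space of all bounded sequences with the supremum norm, as the next two lemmas record.\<close>

lemma bcontfun_nat_iff: "f \<in> bcontfun \<longleftrightarrow> bounded (range f)"
  for f :: "nat \<Rightarrow> 'a::metric_space"
  by (simp add: bcontfun_def)

lemma norm_bcontfun_eq_SUP: "norm f = (SUP n. norm (apply_bcontfun f n))"
  for f :: "nat \<Rightarrow>\<^sub>C 'a::real_normed_vector"
  by (simp add: norm_bcontfun_def dist_bcontfun_def)

text \<open>A bounded family indexed by a set \<open>S\<close> of natural numbers is represented by its extension
  by \<open>0\<close> outside \<open>S\<close>; this changes neither the linear structure nor the supremum norm.\<close>

definition c0_ideal :: "nat set \<Rightarrow> nat set set \<Rightarrow> (nat \<Rightarrow>\<^sub>C 'a::real_normed_vector) set" where
  "c0_ideal S I =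
     {x. (\<forall>s. s \<notin> S \<longrightarrow> apply_bcontfun x s = 0) \<and>
         (\<forall>\<epsilon>>0. {s \<in> S. norm (apply_bcontfun x s) \<ge> \<epsilon>} \<in> I)}"

text \<open>The spaces \<open>X j\<close> are linear subspaces of one ambient normed space, with the inherited
  norm.\<close>

definition linf_sum :: "(nat \<Rightarrow> 'v::real_normed_vector set) \<Rightarrow> (nat \<Rightarrow>\<^sub>C 'v) set" where
  "linf_sum X = {f. \<forall>j. apply_bcontfun f j \<in> X j}"

text \<open>Surjective linear isometry between linear subspaces of normed spaces; the values of \<open>T\<close>
  outside \<open>A\<close> are irrelevant.\<close>

definition isometric_subspaces ::
    "'v::real_normed_vector set \<Rightarrow> 'w::real_normed_vector set \<Rightarrow> bool" where
  "isometric_subspaces A B \<longleftrightarrow>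
     (\<exists>T. (\<forall>x\<in>A. \<forall>y\<in>A. T (x + y) = T x + T y) \<and>
          (\<forall>c. \<forall>x\<in>A. T (c *\<^sub>R x) = c *\<^sub>R T x) \<and>
          (\<forall>x\<in>A. norm (T x) = norm x) \<and>
          T ` A = B)"

lemma subspace_c0_ideal:
  assumes "ideal_on S I"
  shows "subspace (c0_ideal S I :: (nat \<Rightarrow>\<^sub>C 'a::real_normed_vector) set)"
proof -
  have sub: "B \<in> I" if "A \<in> I" "B \<subseteq> A" for A B
    using assms that unfolding ideal_on_def by blast
  have un: "A \<union> B \<in> I" if "A \<in> I" "B \<in> I" for A B
    using assms that unfolding ideal_on_def by blast
  have e: "{} \<in> I" using assms unfolding ideal_on_def by blast
  show ?thesis
  proof (rule subspaceI)
    show "(0 :: nat \<Rightarrow>\<^sub>C 'a) \<in> c0_ideal S I"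
      by (auto simp: c0_ideal_def e not_le)
  next
    fix x y :: "nat \<Rightarrow>\<^sub>C 'a"
    assume x: "x \<in> c0_ideal S I" and y: "y \<in> c0_ideal S I"
    have "{s \<in> S. norm (apply_bcontfun (x + y) s) \<ge> \<epsilon>} \<in> I" if "\<epsilon> > 0" for \<epsilon> :: real
    proof (rule sub)
      have "\<epsilon> / 2 > 0" using that by simp
      then show "{s \<in> S. norm (apply_bcontfun x s) \<ge> \<epsilon> / 2} \<union>
            {s \<in> S. norm (apply_bcontfun y s) \<ge> \<epsilon> / 2} \<in> I"
        using x y unfolding c0_ideal_def by (blast intro: un)
      show "{s \<in> S. norm (apply_bcontfun (x + y) s) \<ge> \<epsilon>} \<subseteq>
            {s \<in> S. norm (apply_bcontfun x s) \<ge> \<epsilon> / 2} \<union>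
            {s \<in> S. norm (apply_bcontfun y s) \<ge> \<epsilon> / 2}"
      proof
        fix s assume "s \<in> {s \<in> S. norm (apply_bcontfun (x + y) s) \<ge> \<epsilon>}"
        then have "s \<in> S" "norm (apply_bcontfun x s + apply_bcontfun y s) \<ge> \<epsilon>"
          by (auto simp: plus_bcontfun.rep_eq)
        moreover have "norm (apply_bcontfun x s + apply_bcontfun y s)
            \<le> norm (apply_bcontfun x s) + norm (apply_bcontfun y s)"
          by (rule norm_triangle_ineq)
        ultimately have "s \<in> S" "norm (apply_bcontfun x s) \<ge> \<epsilon> / 2 \<or> norm (apply_bcontfun y s) \<ge> \<epsilon> / 2"
          by linarith+
        then show "s \<in> {s \<in> S. norm (apply_bcontfun x s) \<ge> \<epsilon> / 2} \<union>
            {s \<in> S. norm (apply_bcontfun y s) \<ge> \<epsilon> / 2}" by blast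
      qed
    qed
    moreover have "apply_bcontfun (x + y) s = 0" if "s \<notin> S" for s
      using x y that by (simp add: c0_ideal_def plus_bcontfun.rep_eq)
    ultimately show "x + y \<in> c0_ideal S I" by (simp add: c0_ideal_def)
  next
    fix c :: real and x :: "nat \<Rightarrow>\<^sub>C 'a"
    assume x: "x \<in> c0_ideal S I"
    have "{s \<in> S. norm (apply_bcontfun (c *\<^sub>R x) s) \<ge> \<epsilon>} \<in> I" if "\<epsilon> > 0" for \<epsilon> :: real
    proof (cases "c = 0")
      case True
      have "{s \<in> S. norm (apply_bcontfun (c *\<^sub>R x) s) \<ge> \<epsilon>} = {}"
        using True that by auto
      then show ?thesis using e by (simp only:)
    next
      case False
      have "{s \<in> S. norm (apply_bcontfun (c *\<^sub>R x) s) \<ge> \<epsilon>} =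
            {s \<in> S. norm (apply_bcontfun x s) \<ge> \<epsilon> / \<bar>c\<bar>}"
        using False by (auto simp: field_simps)
      moreover have "\<epsilon> / \<bar>c\<bar> > 0" using False that by simp
      ultimately show ?thesis using x unfolding c0_ideal_def by simp
    qed
    then show "c *\<^sub>R x \<in> c0_ideal S I" using x by (simp add: c0_ideal_def)
  qed
qed

lemma subspace_linf_sum: "(\<And>j. subspace (X j)) \<Longrightarrow> subspace (linf_sum X)"
  by (auto simp: subspace_def linf_sum_def plus_bcontfun.rep_eq)

end

theory Submission
  imports Defs
begin

text \<open>The isometry cuts a bounded sequence into its restrictions to the pieces \<open>K n\<close>, each
  re-indexed by a bijection \<open>b n\<close> from an index set \<open>S n\<close> onto \<open>K n\<close>. Identity maps give the
  first claim, and \<open>S n = UNIV\<close> gives the second.\<close>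

text \<open>\<open>Bcontfun\<close> is inverted by \<open>apply_bcontfun\<close> only on bounded
  continuous functions; since the domain is discrete, a uniform bound is all there is to
  check.\<close>

lemma apply_Bcontfun_nat:
  fixes f :: "nat \<Rightarrow> 'a::real_normed_vector"
  assumes "\<And>n. norm (f n) \<le> B"
  shows "apply_bcontfun (Bcontfun f) = f"
  by (rule Bcontfun_inverse) (use assms in \<open>auto simp: bcontfun_nat_iff bounded_iff\<close>)

text \<open>The value 0 outside \<open>S\<close> matches the zero extension by which
  \<open>c0_ideal S\<close> represents families indexed by \<open>S\<close>.\<close>

definition pullback :: "(nat \<Rightarrow> nat) \<Rightarrow> nat set \<Rightarrow> (nat \<Rightarrow>\<^sub>C 'a::real_normed_vector) \<Rightarrow> (nat \<Rightarrow>\<^sub>C 'a)" where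
  "pullback b S x = Bcontfun (\<lambda>s. if s \<in> S then apply_bcontfun x (b s) else 0)"

definition split_family :: "(nat \<Rightarrow> nat \<Rightarrow> nat) \<Rightarrow> (nat \<Rightarrow> nat set) \<Rightarrow>
    (nat \<Rightarrow>\<^sub>C 'a::real_normed_vector) \<Rightarrow> (nat \<Rightarrow>\<^sub>C (nat \<Rightarrow>\<^sub>C 'a))" where
  "split_family b S x = Bcontfun (\<lambda>n. pullback (b n) (S n) x)"

lemma apply_pullback:
  "apply_bcontfun (pullback b S x) s = (if s \<in> S then apply_bcontfun x (b s) else 0)"
  unfolding pullback_def
  by (subst apply_Bcontfun_nat[where B = "norm x"]) (auto simp: norm_bounded)

lemma norm_pullback_le: "norm (pullback b S x) \<le> norm x"
  by (rule norm_bound) (auto simp: apply_pullback norm_bounded)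

lemma apply_split_family: "apply_bcontfun (split_family b S x) n = pullback (b n) (S n) x"
  unfolding split_family_def
  by (subst apply_Bcontfun_nat[where B = "norm x"]) (auto simp: norm_pullback_le)

lemma split_family_add: "split_family b S (x + y) = split_family b S x + split_family b S y"
  by (intro bcontfun_eqI) (simp add: apply_split_family apply_pullback plus_bcontfun.rep_eq)

lemma split_family_scaleR: "split_family b S (c *\<^sub>R x) = c *\<^sub>R split_family b S x"
  by (intro bcontfun_eqI) (simp add: apply_split_family apply_pullback)

lemma indexed_partition_transport_cases:
  assumes "indexed_partition K" and "\<And>n. bij_betw (b n) (S n) (K n)"
  obtains n s where "s \<in> S n" and "m = b n s"
proof -
  obtain n where "m \<in> K n"
    using assms(1) unfolding indexed_partition_def by blast
  then have "m \<in> b n ` S n"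
    using bij_betw_imp_surj_on[OF assms(2)[of n]] by simp
  then show thesis using that by blast
qed

text \<open>Restricting can only decrease a supremum. Conversely, the pieces cover the natural
  numbers, so each value of \<open>x\<close> occurs as an entry of some coordinate.\<close>

lemma norm_split_family:
  assumes "indexed_partition K" and "\<And>n. bij_betw (b n) (S n) (K n)"
  shows "norm (split_family b S x) = norm x"
proof (rule antisym)
  show "norm (split_family b S x) \<le> norm x"
    by (rule norm_bound) (simp add: apply_split_family norm_pullback_le)
  show "norm x \<le> norm (split_family b S x)"
  proof (rule norm_bound)
    fix m
    obtain n s where "s \<in> S n" "m = b n s"
      using indexed_partition_transport_cases[OF assms] .
    then have "apply_bcontfun x m = apply_bcontfun (apply_bcontfun (split_family b S x) n) s"
      by (simp add: apply_split_family apply_pullback)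
    also have "norm \<dots> \<le> norm (apply_bcontfun (split_family b S x) n)"
      by (rule norm_bounded)
    also have "\<dots> \<le> norm (split_family b S x)"
      by (rule norm_bounded)
    finally show "norm (apply_bcontfun x m) \<le> norm (split_family b S x)" .
  qed
qed

text \<open>For each \<open>\<epsilon>\<close> and \<open>n\<close>, the map \<open>b n\<close>
  carries the level set of the \<open>n\<close>-th coordinate onto the trace on \<open>K n\<close>
  of the level set of \<open>x\<close>. A direct sum ideal tests exactly these traces, one piece at
  a time, so both sides impose the same conditions with the quantifiers over
  \<open>\<epsilon>\<close> and \<open>n\<close> exchanged.\<close>

lemma split_family_in_linf_sum_iff:
  fixes x :: "nat \<Rightarrow>\<^sub>C 'a::real_normed_vector"
  assumes bij: "\<And>n. bij_betw (b n) (S n) (K n)" and J: "\<And>n. J n \<subseteq> Pow (S n)"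
  shows "split_family b S x \<in> linf_sum (\<lambda>n. c0_ideal (S n) (J n)) \<longleftrightarrow>
    x \<in> c0_ideal UNIV (direct_sum_ideal K (\<lambda>n. (`) (b n) ` J n))"
proof -
  define E where "E \<epsilon> n = {s \<in> S n. norm (apply_bcontfun x (b n s)) \<ge> \<epsilon>}" for \<epsilon> n
  have pullback_level:
    "{s \<in> S n. norm (apply_bcontfun (pullback (b n) (S n) x) s) \<ge> \<epsilon>} = E \<epsilon> n" for \<epsilon> n
    by (auto simp: E_def apply_pullback)
  have image_level: "{m. norm (apply_bcontfun x m) \<ge> \<epsilon>} \<inter> K n = b n ` E \<epsilon> n" for \<epsilon> n
    by (auto simp: E_def bij_betw_imp_surj_on[OF bij[of n], symmetric])
  have image_mem: "b n ` E \<epsilon> n \<in> (`) (b n) ` J n \<longleftrightarrow> E \<epsilon> n \<in> J n" for \<epsilon> n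
  proof
    assume "b n ` E \<epsilon> n \<in> (`) (b n) ` J n"
    then obtain A where A: "A \<in> J n" "b n ` E \<epsilon> n = b n ` A" by blast
    \<comment> \<open>A priori \<open>A\<close> is just some member of \<open>J n\<close> with the
      same image; both sets lie in \<open>S n\<close>, where \<open>b n\<close> is injective, so
      they coincide.\<close>
    have "inj_on (b n) (S n)" using bij by (rule bij_betw_imp_inj_on)
    then have "E \<epsilon> n = A"
      using A J[of n] inj_on_image_eq_iff[of "b n" "S n" "E \<epsilon> n" A] by (auto simp: E_def)
    with A show "E \<epsilon> n \<in> J n" by simp
  qed blast
  \<comment> \<open>A pullback vanishes outside \<open>S n\<close> by construction, so only the
    level set conditions remain.\<close>
  have "split_family b S x \<in> linf_sum (\<lambda>n. c0_ideal (S n) (J n)) \<longleftrightarrow>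
      (\<forall>n. \<forall>\<epsilon>>0. E \<epsilon> n \<in> J n)"
    by (simp add: linf_sum_def c0_ideal_def apply_split_family pullback_level)
      (simp add: apply_pullback)
  also have "\<dots> \<longleftrightarrow> x \<in> c0_ideal UNIV (direct_sum_ideal K (\<lambda>n. (`) (b n) ` J n))"
    by (auto simp: c0_ideal_def direct_sum_ideal_def image_level image_mem)
  finally show ?thesis .
qed

text \<open>The coordinates of \<open>f\<close> are glued: disjointness of the pieces means that no
  two of them prescribe a value at the same point. The support condition is necessary, since every
  coordinate of a split family vanishes outside \<open>S n\<close>.\<close>

lemma split_family_surj:
  fixes f :: "nat \<Rightarrow>\<^sub>C (nat \<Rightarrow>\<^sub>C 'a::real_normed_vector)"
  assumes part: "indexed_partition K" and bij: "\<And>n. bij_betw (b n) (S n) (K n)"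
    and supp: "\<And>n s. s \<notin> S n \<Longrightarrow> apply_bcontfun (apply_bcontfun f n) s = 0"
  obtains x where "split_family b S x = f"
proof -
  define idx where "idx m = (THE n. m \<in> K n)" for m
  define y where
    "y m = apply_bcontfun (apply_bcontfun f (idx m)) (inv_into (S (idx m)) (b (idx m)) m)" for m
  have idx: "idx m = n" if "m \<in> K n" for m n
    unfolding idx_def
    using that part by (intro the_equality) (auto simp: indexed_partition_def disjoint_family_on_def)
  \<comment> \<open>Every \<open>y m\<close> is an entry of some coordinate of \<open>f\<close>,
    whatever \<open>idx\<close> and \<open>inv_into\<close> return, so the two nested supremum norms
    bound it.\<close>
  have "norm (y m) \<le> norm f" for m
    unfolding y_def by (intro order_trans[OF norm_bounded norm_bounded])
  then have y: "apply_bcontfun (Bcontfun y) = y" by (rule apply_Bcontfun_nat)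
  have y_b: "y (b n s) = apply_bcontfun (apply_bcontfun f n) s" if "s \<in> S n" for n s
  proof -
    have "idx (b n s) = n"
      using bij_betwE[OF bij] that by (blast intro: idx)
    moreover have "inv_into (S n) (b n) (b n s) = s"
      using bij_betw_imp_inj_on[OF bij] that by (rule inv_into_f_f)
    ultimately show ?thesis by (simp add: y_def)
  qed
  have "split_family b S (Bcontfun y) = f"
    by (intro bcontfun_eqI) (simp add: apply_split_family apply_pullback y y_b supp)
  then show thesis by (rule that)
qed

theorem isometric_c0_direct_sum_transport:
  assumes part: "indexed_partition K" and bij: "\<And>n. bij_betw (b n) (S n) (K n)"
    and J: "\<And>n. J n \<subseteq> Pow (S n)"
  shows "isometric_subspaces
    (c0_ideal UNIV (direct_sum_ideal K (\<lambda>n. (`) (b n) ` J n)) ::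
      (nat \<Rightarrow>\<^sub>C 'a::real_normed_vector) set)
    (linf_sum (\<lambda>n. c0_ideal (S n) (J n) :: (nat \<Rightarrow>\<^sub>C 'a) set))" (is "isometric_subspaces ?A ?B")
  unfolding isometric_subspaces_def
proof (intro exI[of _ "split_family b S"] conjI ballI allI)
  show "split_family b S ` ?A = ?B"
  proof (intro set_eqI iffI)
    fix f assume "f \<in> split_family b S ` ?A"
    then show "f \<in> ?B" using split_family_in_linf_sum_iff[of b S K J, OF bij J] by blast
  next
    fix f assume f: "f \<in> ?B"
    \<comment> \<open>The zero extension built into \<open>c0_ideal\<close> supplies the support
      condition for gluing. The glued \<open>x\<close> then lies in \<open>?A\<close> because the
      membership lemma is an equivalence.\<close>
    then have "apply_bcontfun (apply_bcontfun f n) s = 0" if "s \<notin> S n" for n s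
      using that by (simp add: linf_sum_def c0_ideal_def)
    then obtain x where "split_family b S x = f"
      using split_family_surj[of K b S f, OF part bij] by blast
    then show "f \<in> split_family b S ` ?A"
      using f split_family_in_linf_sum_iff[of b S K J, OF bij J] by blast
  qed
qed (simp_all add: split_family_add split_family_scaleR norm_split_family[OF part bij])

theorem theorem5p2:
  shows "(\<forall>(K :: nat \<Rightarrow> nat set) (I :: nat \<Rightarrow> nat set set).
            indexed_partition K \<longrightarrow> (\<forall>n. ideal_on (K n) (I n)) \<longrightarrow>
            isometric_subspaces
              (c0_ideal UNIV (direct_sum_ideal K I) :: (nat \<Rightarrow>\<^sub>C 'a::banach) set)
              (linf_sum (\<lambda>n. c0_ideal (K n) (I n) :: (nat \<Rightarrow>\<^sub>C 'a) set))) \<and>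
         (\<forall>(J :: nat set set) (K :: nat \<Rightarrow> nat set) (b :: nat \<Rightarrow> nat \<Rightarrow> nat).
            ideal_on UNIV J \<longrightarrow> indexed_partition K \<longrightarrow> (\<forall>n. infinite (K n)) \<longrightarrow>
            (\<forall>n. bij_betw (b n) UNIV (K n)) \<longrightarrow>
            isometric_subspaces
              (c0_ideal UNIV (omega_power_ideal K b J) :: (nat \<Rightarrow>\<^sub>C 'a) set)
              (linf_sum (\<lambda>n. c0_ideal UNIV J :: (nat \<Rightarrow>\<^sub>C 'a) set)))"
proof (intro conjI allI impI)
  fix K I
  assume "indexed_partition K" and I: "\<forall>n. ideal_on (K n) (I n)"
  moreover have "I n \<subseteq> Pow (K n)" for n
    using I by (simp add: ideal_on_def)
  ultimately show "isometric_subspaces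
      (c0_ideal UNIV (direct_sum_ideal K I) :: (nat \<Rightarrow>\<^sub>C 'a) set)
      (linf_sum (\<lambda>n. c0_ideal (K n) (I n) :: (nat \<Rightarrow>\<^sub>C 'a) set))"
    \<comment> \<open>Under identity maps the transported ideals are the \<open>I n\<close>
      themselves.\<close>
    using isometric_c0_direct_sum_transport[of K "\<lambda>n m. m" K I] by (simp add: bij_betw_def)
next
  fix J K and b :: "nat \<Rightarrow> nat \<Rightarrow> nat"
  assume "indexed_partition K" and "\<forall>n. bij_betw (b n) UNIV (K n)"
  then show "isometric_subspaces
      (c0_ideal UNIV (omega_power_ideal K b J) :: (nat \<Rightarrow>\<^sub>C 'a) set)
      (linf_sum (\<lambda>n. c0_ideal UNIV J :: (nat \<Rightarrow>\<^sub>C 'a) set))"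
    \<comment> \<open>Unfolding exhibits the ideal as a direct sum of transported copies of
      \<open>J\<close>, with every index set equal to \<open>UNIV\<close>.\<close>
    unfolding omega_power_ideal_def
    by (intro isometric_c0_direct_sum_transport) auto
qed

end
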